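(* For every positive integer $k$ there exists a finite one popular color graph $G_k$ with chromatic number $\chi(G_k)\geq k$.
   Context: A graph $G$ is a one popular color graph if its edges admit a coloring such that (1) each vertex is incident with at most two edges of any given color, and (2') every cycle of $G$ contains at least one color on at least two of its edges. *)

theory Defs
  imports Main "HOL-Library.Extended_Nat"
begin

definition simple_graph :: "'a set \<Rightarrow> 'a set set \<Rightarrow> bool" where
  "simple_graph V E \<longleftrightarrow> (\<forall>e\<in>E. e \<subseteq> V \<and> card e = 2)"

text \<open>A cycle is given by the list of its pairwise distinct vertices in cyclic order.\<close>

definition cycle_edges :: "'a list \<Rightarrow> 'a set set" where
  "cycle_edges vs = {{vs ! i, vs ! (Suc i mod length vs)} | i. i < length vs}"

definition is_cycle :: "'a set \<Rightarrow> 'a set set \<Rightarrow> 'a list \<Rightarrow> bool" where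
  "is_cycle V E vs \<longleftrightarrow>
     length vs \<ge> 3 \<and> distinct vs \<and> set vs \<subseteq> V \<and> cycle_edges vs \<subseteq> E"

text \<open>The finiteness conjunct is needed because \<^const>\<open>card\<close> is 0 on infinite sets.\<close>

definition one_popular_coloring :: "'a set \<Rightarrow> 'a set set \<Rightarrow> ('a set \<Rightarrow> 'c) \<Rightarrow> bool" where
  "one_popular_coloring V E c \<longleftrightarrow>
     (\<forall>v\<in>V. \<forall>a. finite {e \<in> E. v \<in> e \<and> c e = a} \<and> card {e \<in> E. v \<in> e \<and> c e = a} \<le> 2) \<and>
     (\<forall>vs. is_cycle V E vs \<longrightarrow>
        (\<exists>e\<in>cycle_edges vs. \<exists>f\<in>cycle_edges vs. e \<noteq> f \<and> c e = c f))"

text \<open>Natural numbers as colors are no restriction for graphs with countably many edges,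
  in particular for finite graphs.\<close>

definition one_popular_color_graph :: "'a set \<Rightarrow> 'a set set \<Rightarrow> bool" where
  "one_popular_color_graph V E \<longleftrightarrow>
     simple_graph V E \<and> (\<exists>c :: 'a set \<Rightarrow> nat. one_popular_coloring V E c)"

definition proper_vertex_coloring ::
    "'a set \<Rightarrow> 'a set set \<Rightarrow> nat \<Rightarrow> ('a \<Rightarrow> nat) \<Rightarrow> bool" where
  "proper_vertex_coloring V E n f \<longleftrightarrow>
     f ` V \<subseteq> {..<n} \<and> (\<forall>u\<in>V. \<forall>v\<in>V. {u, v} \<in> E \<longrightarrow> f u \<noteq> f v)"

text \<open>The infimum is a minimum unless no finite number of colors suffices, in which case it
  is \<open>\<infinity>\<close>.\<close>

definition chromatic_number :: "'a set \<Rightarrow> 'a set set \<Rightarrow> enat" where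
  "chromatic_number V E = (INF n \<in> {n. \<exists>f. proper_vertex_coloring V E n f}. enat n)"

end

theory Submission
  imports Defs "HOL-Library.FuncSet"
begin

text \<open>Tutte's construction of graphs with large chromatic number: take an independent set
  \<open>S\<close> and, for every injection of the vertices of a graph \<open>G\<close> into \<open>S\<close>, a disjoint copy of \<open>G\<close>
  that is joined to \<open>S\<close> by the matching given by the injection.  If \<open>S\<close> is large enough, a proper
  coloring is constant on the image of some injection, and this color is missing on the
  corresponding copy.  Give the matching of each copy a color of its own.  A cycle that is not
  contained in a copy has to enter and to leave some copy, and thus uses the color of that
  matching twice.\<close>

section \<open>Cycles under maps, and cycles that leave a vertex set\<close>

lemma cycle_edges_map: "cycle_edges (map g us) = (`) g ` cycle_edges us"
proof -
  have eq: "cycle_edges ws = (\<lambda>i. {ws ! i, ws ! (Suc i mod length ws)}) ` {..<length ws}"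
    for ws :: "'z list"
    unfolding cycle_edges_def by blast
  have "Suc i mod length us < length us" if "i < length us" for i
    using that by (intro mod_less_divisor) (cases us; simp)
  then show ?thesis
    unfolding eq image_image by (intro image_cong) simp_all
qed

lemma cycle_edges_subset: "e \<in> cycle_edges us \<Longrightarrow> e \<subseteq> set us"
  unfolding cycle_edges_def by (auto intro!: nth_mem mod_less_divisor)

text \<open>Pulls a cycle back along \<open>g\<close>; distinctness of \<open>map g us\<close>
  already makes \<open>us\<close> distinct. Serves both for relabelling a graph and for a cycle
  inside one copy.\<close>

lemma is_cycle_of_map:
  assumes "is_cycle W F (map g us)" "set us \<subseteq> V"
    and "\<And>e. e \<subseteq> V \<Longrightarrow> g ` e \<in> F \<Longrightarrow> e \<in> E"
  shows "is_cycle V E us"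
proof -
  have "cycle_edges us \<subseteq> E"
  proof
    fix e assume "e \<in> cycle_edges us"
    with assms(1,2) cycle_edges_subset[of e us] show "e \<in> E"
      by (intro assms(3)) (auto simp: is_cycle_def cycle_edges_map)
  qed
  with assms(1,2) show ?thesis
    by (simp add: is_cycle_def distinct_map)
qed

text \<open>Repeated steps from \<open>i\<close> modulo \<open>n\<close> visit every index.\<close>

lemma cyclic_closed:
  fixes n :: nat
  assumes "P i" "i < n" "j < n" and step: "\<And>i. i < n \<Longrightarrow> P i \<Longrightarrow> P (Suc i mod n)"
  shows "P j"
proof -
  have "P ((i + l) mod n)" for l
  proof (induction l)
    case 0
    then show ?case using assms by simp
  next
    case (Suc l)
    have "P (Suc ((i + l) mod n) mod n)"
      using Suc assms(2) by (intro step) auto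
    then show ?case by (simp add: mod_Suc_eq)
  qed
  \<comment> \<open>As \<open>i < n\<close>, the sum \<open>i + (n - i + j)\<close> is
    \<open>n + j\<close>, which is \<open>j\<close> modulo \<open>n\<close>.\<close>
  from this[of "n - i + j"] show ?thesis using assms(2,3) by simp
qed

lemma cycle_leaves:
  assumes "x \<in> set vs" "P x" "y \<in> set vs" "\<not> P y"
  obtains i where "i < length vs" "P (vs ! i)" "\<not> P (vs ! (Suc i mod length vs))"
proof -
  obtain i j where "i < length vs" "vs ! i = x" "j < length vs" "vs ! j = y"
    using assms by (auto simp: in_set_conv_nth)
  then show ?thesis
    using cyclic_closed[of "\<lambda>i. P (vs ! i)" i "length vs" j] assms that by blast
qed

text \<open>One edge leaves \<open>X\<close> and one enters it. They could coincide only if two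
  steps along the cycle led back to the start.\<close>

lemma cycle_crosses_twice:
  assumes "length vs \<ge> 3" "distinct vs" "x \<in> set vs" "x \<in> X" "y \<in> set vs" "y \<notin> X"
  obtains e f where "e \<in> cycle_edges vs" "f \<in> cycle_edges vs" "e \<noteq> f"
    "e \<inter> X \<noteq> {}" "\<not> e \<subseteq> X" "f \<inter> X \<noteq> {}" "\<not> f \<subseteq> X"
proof -
  let ?n = "length vs"
  obtain i where i: "i < ?n" "vs ! i \<in> X" "vs ! (Suc i mod ?n) \<notin> X"
    using cycle_leaves[of x vs "\<lambda>v. v \<in> X" y] assms by metis
  obtain j where j: "j < ?n" "vs ! j \<notin> X" "vs ! (Suc j mod ?n) \<in> X"
    using cycle_leaves[of y vs "\<lambda>v. v \<notin> X" x] assms by metis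
  have lt: "Suc i mod ?n < ?n" "Suc j mod ?n < ?n"
    using i(1) by (auto intro!: mod_less_divisor)
  have "{vs ! i, vs ! (Suc i mod ?n)} \<noteq> {vs ! j, vs ! (Suc j mod ?n)}"
  proof
    assume "{vs ! i, vs ! (Suc i mod ?n)} = {vs ! j, vs ! (Suc j mod ?n)}"
    then have "vs ! i = vs ! (Suc j mod ?n)" "vs ! (Suc i mod ?n) = vs ! j"
      using i j by (auto simp: doubleton_eq_iff)
    then have "i = Suc j mod ?n" "j = Suc i mod ?n"
      using nth_eq_iff_index_eq[OF assms(2) i(1) lt(2)]
        nth_eq_iff_index_eq[OF assms(2) j(1) lt(1)] by simp_all
    then have "Suc (Suc i mod ?n) mod ?n = i" by metis
    \<comment> \<open>Without wrapping the index grows by 2; with wrapping it becomes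
      \<open>Suc (Suc i) - ?n\<close>, which is below \<open>i\<close> because \<open>?n\<close> is
      at least 3.\<close>
    moreover have "Suc (Suc i mod ?n) mod ?n \<noteq> i"
      using i(1) assms(1) by (cases "Suc (Suc i) < ?n") (simp_all add: mod_Suc_eq le_mod_geq)
    ultimately show False by contradiction
  qed
  moreover have "{vs ! i, vs ! (Suc i mod ?n)} \<in> cycle_edges vs"
    "{vs ! j, vs ! (Suc j mod ?n)} \<in> cycle_edges vs"
    using i(1) j(1) unfolding cycle_edges_def by blast+
  ultimately show ?thesis
    using that[of "{vs ! i, vs ! (Suc i mod ?n)}" "{vs ! j, vs ! (Suc j mod ?n)}"] i j by auto
qed

section \<open>One popular colorings of finite graphs, and relabelling by natural numbers\<close>

lemma simple_graph_finite: "finite V \<Longrightarrow> simple_graph V E \<Longrightarrow> finite E"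
  unfolding simple_graph_def by (rule finite_subset[of _ "Pow V"]) auto

lemma finite_one_popular_coloringI:
  assumes "finite E"
    and "\<And>v a. v \<in> V \<Longrightarrow> card {e \<in> E. v \<in> e \<and> c e = a} \<le> 2"
    and "\<And>vs. is_cycle V E vs \<Longrightarrow> \<exists>e\<in>cycle_edges vs. \<exists>f\<in>cycle_edges vs. e \<noteq> f \<and> c e = c f"
  shows "one_popular_coloring V E c"
  using assms unfolding one_popular_coloring_def by simp

lemma one_popular_coloring_card:
  "one_popular_coloring V E c \<Longrightarrow> v \<in> V \<Longrightarrow> card {e \<in> E. v \<in> e \<and> c e = a} \<le> 2"
  unfolding one_popular_coloring_def by blast

lemma one_popular_coloring_cycle:
  assumes "one_popular_coloring V E c" "is_cycle V E vs"
  obtains e f where "e \<in> cycle_edges vs" "f \<in> cycle_edges vs" "e \<noteq> f" "c e = c f"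
  using assms unfolding one_popular_coloring_def by blast

text \<open>Tutte's construction changes the types of vertices and colors. Injections of both into
  the naturals return to fixed types, so that the construction can be iterated by induction.\<close>

lemma one_popular_coloring_to_nat:
  fixes V :: "'a set" and c :: "'a set \<Rightarrow> 'c"
  assumes V: "finite V" and E: "simple_graph V E" and c: "one_popular_coloring V E c"
    and chi: "\<nexists>f. proper_vertex_coloring V E k f"
  shows "\<exists>(W :: nat set) F. finite W \<and> one_popular_color_graph W F \<and>
    (\<nexists>f. proper_vertex_coloring W F k f)"
proof -
  have finE: "finite E" using V E by (rule simple_graph_finite)
  have sub: "e \<subseteq> V" "card e = 2" if "e \<in> E" for e
    using E that unfolding simple_graph_def by auto
  obtain g :: "'a \<Rightarrow> nat" where g: "inj_on g V"
    using finite_imp_inj_to_nat_seg[OF V] by metis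
  obtain h :: "'c \<Rightarrow> nat" where h: "inj_on h (c ` E)"
    using finite_imp_inj_to_nat_seg[OF finite_imageI[OF finE]] by metis
  define W where "W = g ` V"
  define F where "F = (`) g ` E"
  define d where "d e = h (c (inv_into V g ` e))" for e
  have inv: "inv_into V g ` g ` e = e" if "e \<subseteq> V" for e
    using g that by (rule inv_into_image_cancel)
  have d: "d (g ` e) = h (c e)" if "e \<subseteq> V" for e
    using inv[OF that] by (simp add: d_def)
  have "finite W" using V by (simp add: W_def)
  moreover have "simple_graph W F"
    unfolding simple_graph_def W_def F_def
    using sub g by (auto simp: card_image inj_on_subset)
  moreover have "one_popular_coloring W F d"
  proof (rule finite_one_popular_coloringI)
    show "finite F" using finE by (simp add: F_def)
  next
    fix w a assume "w \<in> W"
    then obtain v where v: "v \<in> V" "w = g v" by (auto simp: W_def)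
    show "card {e \<in> F. w \<in> e \<and> d e = a} \<le> 2"
    \<comment> \<open>A color outside the range of \<open>h\<close> on used colors occurs on no
      edge; any other comes from exactly one used color \<open>b\<close>, whose class at
      \<open>v\<close> maps onto the class at \<open>w\<close>.\<close>
    proof (cases "a \<in> h ` c ` E")
      case False
      then have none: "{e \<in> F. w \<in> e \<and> d e = a} = {}"
        using sub d by (auto simp: F_def)
      show ?thesis unfolding none by simp
    next
      case True
      then obtain b where b: "b \<in> c ` E" "a = h b" by blast
      have "{e \<in> F. w \<in> e \<and> d e = a} \<subseteq> (`) g ` {e \<in> E. v \<in> e \<and> c e = b}"
      proof
        fix e' assume e': "e' \<in> {e \<in> F. w \<in> e \<and> d e = a}"
        then obtain e where e: "e \<in> E" "e' = g ` e" by (auto simp: F_def)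
        have "v \<in> e" using e' e v sub(1)[OF e(1)] g by (auto dest: inj_onD)
        moreover have "c e = b"
          using e' e b d[OF sub(1)] h by (auto dest: inj_onD)
        ultimately show "e' \<in> (`) g ` {e \<in> E. v \<in> e \<and> c e = b}" using e by blast
      qed
      then have "card {e \<in> F. w \<in> e \<and> d e = a} \<le> card {e \<in> E. v \<in> e \<and> c e = b}"
        using finE by (intro surj_card_le) auto
      also have "\<dots> \<le> 2" using c v(1) by (rule one_popular_coloring_card)
      finally show ?thesis .
    qed
  next
    fix vs assume cyc: "is_cycle W F vs"
    define us where "us = map (inv_into V g) vs"
    have vs: "set vs \<subseteq> g ` V" using cyc by (simp add: is_cycle_def W_def)
    then have "map g us = vs"
      by (auto simp: us_def o_def f_inv_into_f intro!: map_idI)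
    moreover have us: "set us \<subseteq> V"
      using vs by (auto simp: us_def inv_into_into)
    moreover have "e \<in> E" if "e \<subseteq> V" "g ` e \<in> F" for e
      using that inv sub by (metis F_def imageE)
    ultimately have "is_cycle V E us"
      using cyc by (metis is_cycle_of_map)
    then obtain e f where ef: "e \<in> cycle_edges us" "f \<in> cycle_edges us" "e \<noteq> f" "c e = c f"
      using one_popular_coloring_cycle[OF c] by metis
    then have "e \<subseteq> V" "f \<subseteq> V" using us cycle_edges_subset by blast+
    then have "g ` e \<noteq> g ` f" "d (g ` e) = d (g ` f)"
      using ef inv d by metis+
    moreover have "g ` e \<in> cycle_edges vs" "g ` f \<in> cycle_edges vs"
      using ef(1,2) unfolding \<open>map g us = vs\<close>[symmetric] cycle_edges_map by simp_all
    ultimately show "\<exists>e\<in>cycle_edges vs. \<exists>f\<in>cycle_edges vs. e \<noteq> f \<and> d e = d f"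
      by metis
  qed
  moreover have "\<not> proper_vertex_coloring W F k f" for f
  proof
    assume f: "proper_vertex_coloring W F k f"
    have "proper_vertex_coloring V E k (f \<circ> g)"
      unfolding proper_vertex_coloring_def
    proof (intro conjI ballI impI)
      show "(f \<circ> g) ` V \<subseteq> {..<k}"
        using f by (auto simp: proper_vertex_coloring_def W_def)
    next
      fix u v assume "u \<in> V" "v \<in> V" "{u, v} \<in> E"
      moreover from this have "{g u, g v} \<in> F"
        unfolding F_def by (metis image_empty image_eqI image_insert)
      ultimately show "(f \<circ> g) u \<noteq> (f \<circ> g) v"
        using f by (auto simp: proper_vertex_coloring_def W_def)
    qed
    with chi show False by blast
  qed
  ultimately show ?thesis
    unfolding one_popular_color_graph_def by blast
qed

section \<open>Tutte's graph and its coloring\<close>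

definition tutte_copies :: "'a set \<Rightarrow> nat \<Rightarrow> ('a \<Rightarrow> nat) set" where
  "tutte_copies V m = {\<phi> \<in> V \<rightarrow>\<^sub>E {..<m}. inj_on \<phi> V}"

text \<open>\<open>Inl s\<close> is a point of the independent set, \<open>Inr (\<phi>, v)\<close>
  the vertex \<open>v\<close> in the copy belonging to \<open>\<phi>\<close>; the injection itself
  names the copy.\<close>

definition tutte_verts :: "'a set \<Rightarrow> nat \<Rightarrow> (nat + ('a \<Rightarrow> nat) \<times> 'a) set" where
  "tutte_verts V m = Inl ` {..<m} \<union> Inr ` (tutte_copies V m \<times> V)"

definition tutte_edges ::
    "'a set \<Rightarrow> 'a set set \<Rightarrow> nat \<Rightarrow> (nat + ('a \<Rightarrow> nat) \<times> 'a) set set" where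
  "tutte_edges V E m =
     {{Inl (\<phi> v), Inr (\<phi>, v)} | \<phi> v. \<phi> \<in> tutte_copies V m \<and> v \<in> V} \<union>
     {(\<lambda>v. Inr (\<phi>, v)) ` e | \<phi> e. \<phi> \<in> tutte_copies V m \<and> e \<in> E}"

text \<open>All copies reuse the old colors, tagged \<open>Inl\<close>: forgetting the copy recovers
  the original edge. A matching is colored by its own injection; a matching edge has just one
  \<open>Inr\<close> end, so \<open>THE\<close> is well defined there.\<close>

definition tutte_color ::
    "('a set \<Rightarrow> 'c) \<Rightarrow> (nat + ('a \<Rightarrow> nat) \<times> 'a) set \<Rightarrow> 'c + ('a \<Rightarrow> nat)" where
  "tutte_color c e =
     (if e \<subseteq> range Inr then Inl (c {v. \<exists>\<phi>. Inr (\<phi>, v) \<in> e})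
      else Inr (THE \<phi>. \<exists>v. Inr (\<phi>, v) \<in> e))"

lemma tutte_color_copy [simp]: "tutte_color c ((\<lambda>v. Inr (\<phi>, v)) ` e) = Inl (c e)"
proof -
  have eq: "{v. \<exists>\<psi>. Inr (\<psi>, v) \<in> (\<lambda>v. Inr (\<phi>, v)) ` e} = e" by auto
  show ?thesis unfolding tutte_color_def eq by auto
qed

lemma tutte_color_matching [simp]: "tutte_color c {Inl s, Inr (\<phi>, v)} = Inr \<phi>"
  by (auto simp: tutte_color_def)

lemma tutte_edges_cases:
  assumes "e \<in> tutte_edges V E m"
  obtains (matching) \<phi> v where "\<phi> \<in> tutte_copies V m" "v \<in> V" "e = {Inl (\<phi> v), Inr (\<phi>, v)}"
  | (copy) \<phi> e' where "\<phi> \<in> tutte_copies V m" "e' \<in> E" "e = (\<lambda>v. Inr (\<phi>, v)) ` e'"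
  using assms unfolding tutte_edges_def by blast

lemma finite_tutte_verts: "finite V \<Longrightarrow> finite (tutte_verts V m)"
  by (auto simp: tutte_verts_def tutte_copies_def finite_PiE)

lemma simple_graph_tutte:
  assumes "simple_graph V E"
  shows "simple_graph (tutte_verts V m) (tutte_edges V E m)"
  unfolding simple_graph_def
proof (intro ballI conjI)
  fix e assume "e \<in> tutte_edges V E m"
  then show "e \<subseteq> tutte_verts V m"
    using assms
    by (cases rule: tutte_edges_cases)
      (auto simp: tutte_verts_def tutte_copies_def simple_graph_def)
  from \<open>e \<in> tutte_edges V E m\<close> show "card e = 2"
    using assms
    by (cases rule: tutte_edges_cases)
      (auto simp: simple_graph_def card_image inj_on_def)
qed

lemma one_popular_coloring_tutte:
  assumes V: "finite V" and E: "simple_graph V E" and c: "one_popular_coloring V E c"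
  shows "one_popular_coloring (tutte_verts V m) (tutte_edges V E m) (tutte_color c)"
proof (rule finite_one_popular_coloringI)
  have finE: "finite E" using V E by (rule simple_graph_finite)
  show "finite (tutte_edges V E m)"
    using finite_tutte_verts[OF V] simple_graph_tutte[OF E] by (rule simple_graph_finite)
  show "card {e \<in> tutte_edges V E m. x \<in> e \<and> tutte_color c e = a} \<le> 2" (is "card ?C \<le> 2")
    if xV: "x \<in> tutte_verts V m" for x a
  proof (cases a)
    \<comment> \<open>This color occurs only on the matching of \<open>\<psi>\<close>, which has at
      most one edge at each vertex.\<close>
    case (Inr \<psi>)
    have matching: "\<psi> \<in> tutte_copies V m \<and> (\<exists>v\<in>V. e = {Inl (\<psi> v), Inr (\<psi>, v)})"
      if "e \<in> tutte_edges V E m" "tutte_color c e = Inr \<psi>" for e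
      using that by (cases rule: tutte_edges_cases) auto
    have "e = f" if ef: "e \<in> ?C" "f \<in> ?C" for e f
    proof -
      obtain v w where vw: "\<psi> \<in> tutte_copies V m" "v \<in> V" "w \<in> V"
        "e = {Inl (\<psi> v), Inr (\<psi>, v)}" "f = {Inl (\<psi> w), Inr (\<psi>, w)}"
        using ef Inr matching[of e] matching[of f] by auto
      \<comment> \<open>If \<open>x\<close> is in the independent set, this is injectivity of
        \<open>\<psi>\<close>; if \<open>x\<close> is in a copy, \<open>x\<close> itself contains
        \<open>v\<close>.\<close>
      with ef have "v = w" by (auto simp: tutte_copies_def inj_on_def)
      with vw show ?thesis by simp
    qed
    then have "card ?C \<le> Suc 0"
      by (metis (no_types, lifting) card.infinite card_le_Suc0_iff_eq le0)
    then show ?thesis by simp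
  next
    case (Inl b)
    show ?thesis
    proof (cases x)
      case (Inl s)
      \<comment> \<open>Points of the independent set meet only matching edges, and these have
        \<open>Inr\<close> colors.\<close>
      have none: "?C = {}"
        using \<open>a = Inl b\<close> Inl by (auto elim!: tutte_edges_cases)
      show ?thesis unfolding none by simp
    next
      case (Inr p)
      then obtain \<phi> v where x: "x = Inr (\<phi>, v)" "v \<in> V"
        using xV by (auto simp: tutte_verts_def)
      \<comment> \<open>Edges with an old color at a copy vertex stay inside its copy, so the bound
        for \<open>c\<close> at \<open>v\<close> carries over.\<close>
      have "?C \<subseteq> (`) (\<lambda>v. Inr (\<phi>, v)) ` {e \<in> E. v \<in> e \<and> c e = b}"
        using \<open>a = Inl b\<close> x by (auto elim!: tutte_edges_cases)
      then have "card ?C \<le> card {e \<in> E. v \<in> e \<and> c e = b}"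
        using finE by (intro surj_card_le) auto
      also have "\<dots> \<le> 2" using c x(2) by (rule one_popular_coloring_card)
      finally show ?thesis .
    qed
  qed
  show "\<exists>e\<in>cycle_edges vs. \<exists>f\<in>cycle_edges vs. e \<noteq> f \<and> tutte_color c e = tutte_color c f"
    if cyc: "is_cycle (tutte_verts V m) (tutte_edges V E m) vs" for vs
  proof -
    have vs: "length vs \<ge> 3" "distinct vs" "set vs \<subseteq> tutte_verts V m"
      "cycle_edges vs \<subseteq> tutte_edges V E m"
      using cyc by (auto simp: is_cycle_def)
    \<comment> \<open>No edge lies within the independent set, so any edge of the cycle, here the
      first, meets some copy.\<close>
    have "{vs ! 0, vs ! (Suc 0 mod length vs)} \<in> cycle_edges vs"
      using vs(1) unfolding cycle_edges_def by fastforce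
    then obtain e0 where e0: "e0 \<in> cycle_edges vs" "e0 \<in> tutte_edges V E m" using vs(4) by blast
    from e0(2) obtain \<phi> u where u: "Inr (\<phi>, u) \<in> e0"
    proof (cases rule: tutte_edges_cases)
      case (copy \<phi> e')
      then have "e' \<noteq> {}" using E by (auto simp: simple_graph_def)
      with copy that show ?thesis by blast
    qed (use that in blast)
    then have u_vs: "Inr (\<phi>, u) \<in> set vs" using e0 cycle_edges_subset by blast
    let ?g = "\<lambda>v. Inr (\<phi>, v) :: nat + ('a \<Rightarrow> nat) \<times> 'a"
    define X where "X = range ?g"
    have u_X: "Inr (\<phi>, u) \<in> X" by (simp add: X_def)
    show ?thesis
    proof (cases "set vs \<subseteq> X")
      case False
      then obtain y where y: "y \<in> set vs" "y \<notin> X" by blast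
      obtain e f where ef: "e \<in> cycle_edges vs" "f \<in> cycle_edges vs" "e \<noteq> f"
        "e \<inter> X \<noteq> {}" "\<not> e \<subseteq> X" "f \<inter> X \<noteq> {}" "\<not> f \<subseteq> X"
        using cycle_crosses_twice[OF vs(1,2) u_vs u_X y] .
      \<comment> \<open>Only the matching of \<open>\<phi>\<close> joins this copy to the rest of
        the graph, so both crossing edges have its color.\<close>
      have "tutte_color c e = Inr \<phi>" if "e \<in> tutte_edges V E m" "e \<inter> X \<noteq> {}" "\<not> e \<subseteq> X" for e
        using that by (cases rule: tutte_edges_cases) (auto simp: X_def)
      with ef vs(4) show ?thesis by (metis subsetD)
    next
      case True
      define us where "us = map (\<lambda>x. snd (projr x)) vs"
      have map_us: "map ?g us = vs"
        using True by (auto simp: us_def X_def intro!: map_idI)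
      have us: "set us \<subseteq> V"
        using True vs(3) by (fastforce simp: us_def X_def tutte_verts_def)
      \<comment> \<open>A matching edge has an \<open>Inl\<close> end and so is no image under
        \<open>?g\<close>; for a copy edge, projecting the copy away gives
        \<open>e = e'\<close>.\<close>
      have edge: "e \<in> E" if "?g ` e \<in> tutte_edges V E m" for e
        using that
      proof (cases rule: tutte_edges_cases)
        case (matching \<psi> v)
        then show ?thesis by blast
      next
        case (copy \<psi> e')
        from arg_cong[OF copy(3), of "\<lambda>A. (\<lambda>x. snd (projr x)) ` A"] copy(2)
        show ?thesis by (simp add: image_image)
      qed
      have "is_cycle V E us"
        using cyc us edge unfolding map_us[symmetric] by (rule is_cycle_of_map)
      then obtain e f where ef: "e \<in> cycle_edges us" "f \<in> cycle_edges us" "e \<noteq> f" "c e = c f"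
        using one_popular_coloring_cycle[OF c] by metis
      have "?g ` e \<noteq> ?g ` f"
        using ef(3) by (simp add: inj_image_eq_iff inj_on_def)
      moreover have "?g ` e \<in> cycle_edges vs" "?g ` f \<in> cycle_edges vs"
        using ef(1,2) unfolding map_us[symmetric] cycle_edges_map by simp_all
      ultimately show ?thesis using ef(4) by (metis tutte_color_copy)
    qed
  qed
qed

section \<open>Chromatic number of Tutte's graph, and the induction\<close>

lemma tutte_not_colorable:
  assumes V: "finite V" and chi: "\<nexists>f. proper_vertex_coloring V E k f"
    and m: "m > Suc k * card V"
  shows "\<nexists>f. proper_vertex_coloring (tutte_verts V m) (tutte_edges V E m) (Suc k) f"
proof
  assume "\<exists>f. proper_vertex_coloring (tutte_verts V m) (tutte_edges V E m) (Suc k) f"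
  then obtain f
    where f: "proper_vertex_coloring (tutte_verts V m) (tutte_edges V E m) (Suc k) f" ..
  from f have range: "f ` tutte_verts V m \<subseteq> {..<Suc k}"
    and proper: "\<lbrakk>u \<in> tutte_verts V m; v \<in> tutte_verts V m; {u, v} \<in> tutte_edges V E m\<rbrakk>
      \<Longrightarrow> f u \<noteq> f v"
    for u v
    unfolding proper_vertex_coloring_def by simp_all
  define S where "S a = {s \<in> {..<m}. f (Inl s) = a}" for a
  have "\<exists>a. card V \<le> card (S a)"
  proof (rule ccontr)
    assume "\<not> ?thesis"
    \<comment> \<open>The strict bound on \<open>m\<close> lets the weak inequality suffice:
      \<open>Suc k\<close> classes of size at most \<open>card V\<close> cannot cover
      \<open>m\<close> points.\<close>
    then have small: "card (S a) \<le> card V" for a by (meson nat_le_linear)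
    have "{..<m} \<subseteq> (\<Union>a\<in>{..<Suc k}. S a)"
      using range by (auto simp: S_def tutte_verts_def)
    then have "m \<le> card (\<Union>a\<in>{..<Suc k}. S a)"
      using card_mono[of "\<Union>a\<in>{..<Suc k}. S a" "{..<m}"] by (simp add: S_def)
    also have "\<dots> \<le> (\<Sum>a<Suc k. card (S a))" by (rule card_UN_le) simp
    also have "\<dots> \<le> Suc k * card V" using sum_bounded_above[of "{..<Suc k}", OF small] by simp
    finally show False using m by simp
  qed
  then obtain a where "card V \<le> card (S a)" ..
  then obtain g where g: "g ` V \<subseteq> S a" "inj_on g V"
    using card_le_inj[OF V, of "S a"] by (auto simp: S_def)
  \<comment> \<open>\<open>tutte_copies\<close> consists of extensional functions, which keeps it
    finite, so \<open>g\<close> is cut down to \<open>V\<close>.\<close>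
  define \<phi> where "\<phi> = restrict g V"
  have \<phi>: "\<phi> \<in> tutte_copies V m"
    using g by (auto simp: \<phi>_def tutte_copies_def S_def inj_on_def)
  have vert: "Inr (\<phi>, v) \<in> tutte_verts V m" if "v \<in> V" for v
    using \<phi> that by (simp add: tutte_verts_def)
  have avoid: "f (Inr (\<phi>, v)) \<noteq> a" if "v \<in> V" for v
  proof -
    have "g v \<in> S a" "\<phi> v = g v" using that g by (auto simp: \<phi>_def)
    moreover have "{Inl (\<phi> v), Inr (\<phi>, v)} \<in> tutte_edges V E m"
      using \<phi> that unfolding tutte_edges_def by blast
    ultimately show ?thesis
      using proper[of "Inl (\<phi> v)" "Inr (\<phi>, v)"] vert[OF that] by (auto simp: S_def tutte_verts_def)
  qed
  \<comment> \<open>The color \<open>a\<close> is free on this copy, so the vertices of color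
    \<open>k\<close> can take it over, leaving only colors below \<open>k\<close>. If
    \<open>a = k\<close>, no vertex of the copy has color \<open>k\<close>.\<close>
  define f' where "f' v = (if f (Inr (\<phi>, v)) = k then a else f (Inr (\<phi>, v)))" for v
  \<comment> \<open>The empty graph is colorable with any number of colors. A vertex of
    \<open>V\<close> yields a point of \<open>S a\<close>, so \<open>a\<close> is a color that
    \<open>f\<close> really uses.\<close>
  have "V \<noteq> {}" using chi unfolding proper_vertex_coloring_def by auto
  then have "S a \<noteq> {}" using g by blast
  then have "a < Suc k" using range by (auto simp: S_def tutte_verts_def)
  have "proper_vertex_coloring V E k f'"
    unfolding proper_vertex_coloring_def
  proof (intro conjI ballI impI subsetI)
    fix b assume "b \<in> f' ` V"
    then obtain v where v: "v \<in> V" "b = f' v" by blast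
    then have "f (Inr (\<phi>, v)) < Suc k" using range vert by blast
    then show "b \<in> {..<k}"
      using v avoid[OF v(1)] \<open>a < Suc k\<close> by (auto simp: f'_def)
  next
    fix u v assume uv: "u \<in> V" "v \<in> V" "{u, v} \<in> E"
    have "(\<lambda>v. Inr (\<phi>, v)) ` {u, v} \<in> tutte_edges V E m"
      using \<phi> uv(3) unfolding tutte_edges_def by blast
    then have "f (Inr (\<phi>, u)) \<noteq> f (Inr (\<phi>, v))"
      using uv vert by (intro proper) auto
    then show "f' u \<noteq> f' v" using uv avoid by (auto simp: f'_def)
  qed
  with chi show False by blast
qed

lemma ex_one_popular_not_colorable:
  "\<exists>(V :: nat set) E. finite V \<and> one_popular_color_graph V E \<and>
     (\<nexists>f. proper_vertex_coloring V E k f)"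
proof (induction k)
  case 0
  \<comment> \<open>A single vertex already defeats zero colors; the empty graph would not.\<close>
  have "one_popular_coloring {0} {} (\<lambda>_. 0 :: nat)"
    by (rule finite_one_popular_coloringI) (auto simp: is_cycle_def cycle_edges_def dest: spec[of _ 0])
  then have "one_popular_color_graph {0 :: nat} {}"
    unfolding one_popular_color_graph_def simple_graph_def by blast
  moreover have "\<nexists>f. proper_vertex_coloring {0 :: nat} {} 0 f"
    by (simp add: proper_vertex_coloring_def)
  ultimately show ?case by blast
next
  case (Suc k)
  then obtain V :: "nat set" and E and c :: "nat set \<Rightarrow> nat"
    where G: "finite V" "simple_graph V E" "one_popular_coloring V E c"
      "\<nexists>f. proper_vertex_coloring V E k f"
    unfolding one_popular_color_graph_def by blast
  show ?case
    \<comment> \<open>\<open>lessI\<close> makes the independent set of size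
      \<open>Suc (Suc k * card V)\<close>, just above the pigeonhole bound.\<close>
    using one_popular_coloring_to_nat[OF finite_tutte_verts[OF G(1)] simple_graph_tutte[OF G(2)]
        one_popular_coloring_tutte[OF G(1-3)] tutte_not_colorable[OF G(1,4) lessI]] .
qed

theorem theorem3p3:
  fixes k :: nat
  assumes "k \<ge> 1"
  shows "\<exists>(V :: nat set) (E :: nat set set).
           finite V \<and> one_popular_color_graph V E \<and> chromatic_number V E \<ge> enat k"
proof -
  obtain V :: "nat set" and E where G: "finite V" "one_popular_color_graph V E"
    "\<nexists>f. proper_vertex_coloring V E k f"
    using ex_one_popular_not_colorable by blast
  \<comment> \<open>A coloring with fewer than \<open>k\<close> colors is also one with
    \<open>k\<close> colors, so every number in the infimum is at least \<open>k\<close>.\<close>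
  have "k \<le> n" if "proper_vertex_coloring V E n f" for n f
  proof (rule ccontr)
    assume "\<not> k \<le> n"
    with that have "proper_vertex_coloring V E k f"
      unfolding proper_vertex_coloring_def by fastforce
    with G(3) show False by blast
  qed
  then have "enat k \<le> chromatic_number V E"
    unfolding chromatic_number_def by (auto intro!: INF_greatest)
  with G show ?thesis by blast
qed

end
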